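(* Consider the structural time series, for $t\in\mathbb Z$, $$\mathbf Z_t=h_Z(X_{t-1},\dots,X_{t-q_Z},Y_{t-1},\dots,Y_{t-q_Z},\mathbf Z_{t-1},\dots,\mathbf Z_{t-q_Z},\varepsilon^Z_t),$$ $$X_t=h_X(X_{t-1},\dots,X_{t-q_X},Y_{t-1},\dots,Y_{t-q_X},\mathbf Z_{t-1},\dots,\mathbf Z_{t-q_X},\varepsilon^X_t),$$ $$Y_t=h_Y(X_{t-1},\dots,X_{t-q_Y},Y_{t-1},\dots,Y_{t-q_Y},\mathbf Z_{t-1},\dots,\mathbf Z_{t-q_Y},\varepsilon^Y_t).$$ Assume that $h_X,h_Y,h_Z$ are upper-tail preserving. Assume further that for every $t$ and every $m\ge1$, $(\varepsilon^X_{t+1},\dots,\varepsilon^X_{t+m},\varepsilon^Y_{t+1},\dots,\varepsilon^Y_{t+m},\varepsilon^Z_{t+1},\dots,\varepsilon^Z_{t+m})$ is conditionally independent of $X_t$ given $\mathcal C_t^{-X_t}$. Then, if $$\ell_t:=\min\{s\ge1:\ Y_{t+s}\text{ is not conditionally independent of }X_t\text{ given }\mathcal C_t^{-X_t}\}<\infty,$$ it holds that $\Gamma^t_{\mathbf X\to\mathbf Y\mid\mathcal C}(p)=1$ for every $p\ge\ell_t$.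
   Context: $X_t,Y_t$ are real-valued, supported on some neighborhood of infinity, $\mathbf Z_t$ is finite-dimensional, and $q_X,q_Y,q_Z\in\mathbb N$. $\mathcal C_t^{-X_t}=\sigma(X_s:s<t;\ Y_s,\mathbf Z_s:s\le t)$. $F$ is a cumulative distribution function with $F(x)<1$ for all $x\in\mathbb R$, and $$\Gamma^t_{\mathbf X\to\mathbf Y\mid\mathcal C}(p)=\lim_{v\to\infty}\mathbb E[\max\{F(Y_{t+1}),\dots,F(Y_{t+p})\}\mid X_t>v,\mathcal C_t^{-X_t}],$$ with $\mathbb E[\,\cdot\mid X_t>v,\mathcal G]=\mathbb E[\,\cdot\,\mathbf 1\{X_t>v\}\mid\mathcal G]/P(X_t>v\mid\mathcal G)$ (these conditional quantities are assumed well defined; equality to $1$ is a.s.). Upper-tail preserving: a continuous $h:\mathbb R^m\to\mathbb R$ is upper-tail preserving if for every non-empty $I\subset\{1,\dots,m\}$, either $h$ is constant in the coordinates $(x_i)_{i\in I}$, or for every compact $K\subset\mathbb R^{m-|I|}$, $$\lim_{r\to\infty}\inf_{x_i\ge r\ (i\in I),\ x_{-I}\in K}h(x_1,\dots,x_m)=\infty,$$ where $x_{-I}=(x_i)_{i\notin I}$. For the vector-valued function $h_Z$ the property is required of each coordinate function. *)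

theory Defs
  imports "HOL-Probability.Probability"
begin

section \<open>Upper-tail preserving functions\<close>

text \<open>Euclidean space of dimension \<open>m\<close> is rendered as the real power \<^term>\<open>powertop_real J\<close> of a
  finite set \<open>J\<close> of \<open>m\<close> coordinates; its points are the functions extensional on \<open>J\<close>.\<close>

definition constant_in_coords :: "'i set \<Rightarrow> 'i set \<Rightarrow> (('i \<Rightarrow> real) \<Rightarrow> real) \<Rightarrow> bool" where
  "constant_in_coords J I h \<longleftrightarrow>
     (\<forall>x \<in> topspace (powertop_real J). \<forall>y \<in> topspace (powertop_real J).
        (\<forall>j \<in> J - I. x j = y j) \<longrightarrow> h x = h y)"

text \<open>The infimum is taken in the extended reals, so that it is \<open>\<infinity>\<close> for empty \<open>K\<close> and
  \<open>-\<infinity>\<close> when \<open>h\<close> is unbounded below.\<close>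

definition upper_tail_preserving :: "'i set \<Rightarrow> (('i \<Rightarrow> real) \<Rightarrow> real) \<Rightarrow> bool" where
  "upper_tail_preserving J h \<longleftrightarrow>
     continuous_map (powertop_real J) euclideanreal h \<and>
     (\<forall>I. I \<subseteq> J \<and> I \<noteq> {} \<longrightarrow>
        constant_in_coords J I h \<or>
        (\<forall>K. compactin (powertop_real (J - I)) K \<longrightarrow>
           ((\<lambda>r::real. INF x \<in> {x \<in> topspace (powertop_real J).
                                  (\<forall>i\<in>I. r \<le> x i) \<and> restrict x (J - I) \<in> K}. ereal (h x))
              \<longlongrightarrow> \<infinity>) at_top))"


section \<open>Structural time series\<close>

text \<open>\<open>XLag i\<close> is the slot of \<open>X\<close> at lag \<open>i\<close>, \<open>YLag i\<close> that of \<open>Y\<close>, \<open>ZLag i k\<close> that of the \<open>k\<close>-th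
  component of \<open>Z\<close>, and \<open>Noise k\<close> that of the \<open>k\<close>-th component of the current noise variable.\<close>

datatype ('d, 'e) coord = XLag nat | YLag nat | ZLag nat 'd | Noise 'e

definition coords :: "nat \<Rightarrow> ('d, 'e) coord set" where
  "coords q = XLag ` {1..q} \<union> YLag ` {1..q} \<union> {ZLag i k |i k. i \<in> {1..q}} \<union> range Noise"

definition inputs ::
  "nat \<Rightarrow> (int \<Rightarrow> 'w \<Rightarrow> real) \<Rightarrow> (int \<Rightarrow> 'w \<Rightarrow> real) \<Rightarrow> (int \<Rightarrow> 'w \<Rightarrow> real ^ 'd) \<Rightarrow>
   (int \<Rightarrow> 'w \<Rightarrow> real ^ 'e) \<Rightarrow> int \<Rightarrow> 'w \<Rightarrow> ('d, 'e) coord \<Rightarrow> real" where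
  "inputs q X Y Z eps t \<omega> =
     restrict (\<lambda>c. case c of
         XLag i \<Rightarrow> X (t - int i) \<omega>
       | YLag i \<Rightarrow> Y (t - int i) \<omega>
       | ZLag i k \<Rightarrow> Z (t - int i) \<omega> $ k
       | Noise k \<Rightarrow> eps t \<omega> $ k) (coords q)"

definition past_without_X ::
  "'w measure \<Rightarrow> (int \<Rightarrow> 'w \<Rightarrow> real) \<Rightarrow> (int \<Rightarrow> 'w \<Rightarrow> real) \<Rightarrow> (int \<Rightarrow> 'w \<Rightarrow> real ^ 'd) \<Rightarrow> int
     \<Rightarrow> 'w measure" where
  "past_without_X M X Y Z t =
     sigma (space M)
       ({X s -` B \<inter> space M |s B. s < t \<and> B \<in> sets borel} \<union>
        {Y s -` B \<inter> space M |s B. s \<le> t \<and> B \<in> sets borel} \<union>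
        {Z s -` B \<inter> space M |s B. s \<le> t \<and> B \<in> sets borel})"

text \<open>The noise vector over the times \<open>t+1,\<dots>,t+m\<close>, with values in the product space below.\<close>

definition future_noise ::
  "(int \<Rightarrow> 'w \<Rightarrow> real ^ 'a) \<Rightarrow> (int \<Rightarrow> 'w \<Rightarrow> real ^ 'b) \<Rightarrow> (int \<Rightarrow> 'w \<Rightarrow> real ^ 'c) \<Rightarrow> int \<Rightarrow> nat \<Rightarrow> 'w
     \<Rightarrow> (nat \<Rightarrow> real ^ 'a) \<times> (nat \<Rightarrow> real ^ 'b) \<times> (nat \<Rightarrow> real ^ 'c)" where
  "future_noise eX eY eZ t m \<omega> =
     (\<lambda>i\<in>{1..m}. eX (t + int i) \<omega>,
      \<lambda>i\<in>{1..m}. eY (t + int i) \<omega>,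
      \<lambda>i\<in>{1..m}. eZ (t + int i) \<omega>)"

definition noise_space ::
  "nat \<Rightarrow> ((nat \<Rightarrow> real ^ 'a) \<times> (nat \<Rightarrow> real ^ 'b) \<times> (nat \<Rightarrow> real ^ 'c)) measure" where
  "noise_space m =
     (\<Pi>\<^sub>M i\<in>{1..m}. borel) \<Otimes>\<^sub>M (\<Pi>\<^sub>M i\<in>{1..m}. borel) \<Otimes>\<^sub>M (\<Pi>\<^sub>M i\<in>{1..m}. borel)"


section \<open>Conditional independence and the causal tail coefficient\<close>

definition cond_indep ::
  "'w measure \<Rightarrow> 'w measure \<Rightarrow> 'a measure \<Rightarrow> ('w \<Rightarrow> 'a) \<Rightarrow> 'b measure \<Rightarrow> ('w \<Rightarrow> 'b) \<Rightarrow> bool" where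
  "cond_indep M G N U N' V \<longleftrightarrow>
     (\<forall>A \<in> sets N. \<forall>B \<in> sets N'. AE \<omega> in M.
        real_cond_exp M G (indicator (U -` A \<inter> V -` B \<inter> space M)) \<omega> =
        real_cond_exp M G (indicator (U -` A \<inter> space M)) \<omega> *
        real_cond_exp M G (indicator (V -` B \<inter> space M)) \<omega>)"

text \<open>The support of the law of \<open>V\<close> contains some half-line \<open>(a, \<infinity>)\<close>.\<close>

definition supported_near_infinity :: "'w measure \<Rightarrow> ('w \<Rightarrow> real) \<Rightarrow> bool" where
  "supported_near_infinity M V \<longleftrightarrow>
     (\<exists>a. \<forall>U. open U \<and> U \<inter> {a<..} \<noteq> {} \<longrightarrow> 0 < measure M (V -` U \<inter> space M))"

definition cond_prob_exceed :: "'w measure \<Rightarrow> 'w measure \<Rightarrow> ('w \<Rightarrow> real) \<Rightarrow> real \<Rightarrow> 'w \<Rightarrow> real" where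
  "cond_prob_exceed M G V v = real_cond_exp M G (indicator {\<omega> \<in> space M. v < V \<omega>})"

definition cond_exp_exceed ::
  "'w measure \<Rightarrow> 'w measure \<Rightarrow> ('w \<Rightarrow> real) \<Rightarrow> real \<Rightarrow> ('w \<Rightarrow> real) \<Rightarrow> 'w \<Rightarrow> real" where
  "cond_exp_exceed M G V v W \<omega> =
     real_cond_exp M G (\<lambda>\<omega>. W \<omega> * indicator {\<omega> \<in> space M. v < V \<omega>} \<omega>) \<omega> /
     cond_prob_exceed M G V v \<omega>"

text \<open>For each single level \<open>v\<close> the conditional expectation is determined only up to a null set, so
  an almost sure limit over all real levels at once would depend on the choice of versions.
  We therefore ask for the almost sure limit (with one exceptional null set) as \<open>v\<close> tends to infinity
  through \<open>Q\<close>, for every countable set \<open>Q\<close> of levels. This does not depend on the versions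
  chosen. It includes all sequences of levels; and, taking a dense \<open>Q\<close>, it yields the limit over
  all real \<open>v\<close> for any version that is right-continuous in \<open>v\<close>, such as the one computed from a
  regular conditional distribution.\<close>

definition cond_exp_exceed_limit ::
  "'w measure \<Rightarrow> 'w measure \<Rightarrow> ('w \<Rightarrow> real) \<Rightarrow> ('w \<Rightarrow> real) \<Rightarrow> ('w \<Rightarrow> real) \<Rightarrow> bool" where
  "cond_exp_exceed_limit M G V W L \<longleftrightarrow>
     (\<forall>Q :: real set. countable Q \<longrightarrow>
        (AE \<omega> in M. ((\<lambda>v. cond_exp_exceed M G V v W \<omega>) \<longlongrightarrow> L \<omega>) (inf at_top (principal Q))))"

text \<open>\<open>causal_tail_coeff_is M X Y Z F t p g\<close> says that the coefficient \<open>\<Gamma>\<close> at time \<open>t\<close> with horizon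
  \<open>p\<close> exists and is almost surely equal to the random variable \<open>g\<close>.\<close>

definition causal_tail_coeff_is ::
  "'w measure \<Rightarrow> (int \<Rightarrow> 'w \<Rightarrow> real) \<Rightarrow> (int \<Rightarrow> 'w \<Rightarrow> real) \<Rightarrow> (int \<Rightarrow> 'w \<Rightarrow> real ^ 'd) \<Rightarrow> (real \<Rightarrow> real)
     \<Rightarrow> int \<Rightarrow> nat \<Rightarrow> ('w \<Rightarrow> real) \<Rightarrow> bool" where
  "causal_tail_coeff_is M X Y Z F t p g \<longleftrightarrow>
     cond_exp_exceed_limit M (past_without_X M X Y Z t) (X t)
       (\<lambda>\<omega>. Max ((\<lambda>s. F (Y (t + int s) \<omega>)) ` {1..p})) g"

text \<open>The smallest lag of dependence; it is \<open>\<infinity>\<close> when there is no such lag.\<close>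

definition min_lag ::
  "'w measure \<Rightarrow> (int \<Rightarrow> 'w \<Rightarrow> real) \<Rightarrow> (int \<Rightarrow> 'w \<Rightarrow> real) \<Rightarrow> (int \<Rightarrow> 'w \<Rightarrow> real ^ 'd) \<Rightarrow> int \<Rightarrow> enat"
  where
  "min_lag M X Y Z t =
     Inf (enat ` {s. 1 \<le> s \<and>
       \<not> cond_indep M (past_without_X M X Y Z t) borel (Y (t + int s)) borel (X t)})"

end

theory Submission
  imports Defs
begin

text \<open>Unrolling the recursion writes every variable at time \<open>t + n\<close> as \<open>\<phi> (X\<^sub>t, \<cdot>)\<close>, where \<open>\<phi> (x, \<cdot>)\<close>
  is measurable with respect to the \<open>\<sigma>\<close>-algebra \<open>H\<close> generated by the conditioning \<open>\<sigma>\<close>-algebra \<open>G\<close> and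
  the future noise. Upper-tail preservation passes a dichotomy through the recursion: either \<open>\<phi>\<close> does
  not depend on \<open>x\<close>, or \<open>\<phi> (x, \<cdot>)\<close> tends to infinity with \<open>x\<close> pointwise. Since \<open>X\<^sub>t\<close> is conditionally
  independent of \<open>H\<close> given \<open>G\<close>, the first case is impossible at the lag \<open>\<ell>\<^sub>t\<close>. In the second case the
  event \<open>A\<^sub>n\<close> that \<open>\<phi> (x, \<cdot>) \<ge> k\<close> for all \<open>x > n\<close> lies in \<open>H\<close>, so for \<open>v \<ge> n\<close> the conditional
  expectation given \<open>X\<^sub>t > v\<close> is at least \<open>F k \<cdot> P (A\<^sub>n | G)\<close>, which tends to \<open>F k\<close> as \<open>n\<close> grows,
  and then to 1 as \<open>k\<close> grows.\<close>

section \<open>Conditional independence of a generated algebra\<close>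

text \<open>This is the \<sigma>-algebra generated jointly by \<open>G\<close> and \<open>U\<close>.
  Generating it by intersections of a set of \<open>G\<close> with a preimage under
  \<open>U\<close>, rather than by the two classes separately, makes the generator closed under
  finite intersections, as the uniqueness theorem for measures requires.\<close>

definition join_algebra :: "'w measure \<Rightarrow> 'w measure \<Rightarrow> 'a measure \<Rightarrow> ('w \<Rightarrow> 'a) \<Rightarrow> 'w measure" where
  "join_algebra M G N U =
     sigma (space M) {c \<inter> (U -` S \<inter> space M) |c S. c \<in> sets G \<and> S \<in> sets N}"

lemma
  assumes "subalgebra M G"
  shows space_join_algebra [simp]: "space (join_algebra M G N U) = space M"
    and sets_join_algebra: "sets (join_algebra M G N U) =
      sigma_sets (space M) {c \<inter> (U -` S \<inter> space M) |c S. c \<in> sets G \<and> S \<in> sets N}"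
proof -
  have "{c \<inter> (U -` S \<inter> space M) |c S. c \<in> sets G \<and> S \<in> sets N} \<subseteq> Pow (space M)" by auto
  then show "space (join_algebra M G N U) = space M" 
    "sets (join_algebra M G N U) =
      sigma_sets (space M) {c \<inter> (U -` S \<inter> space M) |c S. c \<in> sets G \<and> S \<in> sets N}"
    unfolding join_algebra_def by simp_all
qed

lemma subalgebra_join_algebra:
  assumes "subalgebra M G" and U: "U \<in> measurable M N"
  shows "subalgebra M (join_algebra M G N U)"
proof -
  have "{c \<inter> (U -` S \<inter> space M) |c S. c \<in> sets G \<and> S \<in> sets N} \<subseteq> sets M"
    using assms(1) measurable_sets[OF U] unfolding subalgebra_def by blast
  then show ?thesis
    unfolding subalgebra_def sets_join_algebra[OF assms(1)]
    by (simp add: assms(1) sets.sigma_sets_subset)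
qed

lemma subalgebra_of_join_algebra:
  assumes "subalgebra M G" and U: "U \<in> measurable M N"
  shows "subalgebra (join_algebra M G N U) G"
proof -
  have "c \<in> sets (join_algebra M G N U)" if "c \<in> sets G" for c
  proof -
    have "c \<subseteq> space M" using that assms(1) sets.sets_into_space unfolding subalgebra_def by blast
    moreover have "U -` space N \<inter> space M = space M"
      using measurable_space[OF U] by auto
    ultimately have "c = c \<inter> (U -` space N \<inter> space M)" by auto
    then show ?thesis
      unfolding sets_join_algebra[OF assms(1)] using that by (intro sigma_sets.Basic) blast
  qed
  then show ?thesis
    using assms(1) unfolding subalgebra_def by (auto simp: space_join_algebra[OF assms(1)])
qed

lemma measurable_join_algebra:
  assumes "subalgebra M G" and U: "U \<in> measurable M N"
  shows "U \<in> measurable (join_algebra M G N U) N"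
proof (rule measurableI)
  fix S assume S: "S \<in> sets N"
  have "space M \<in> sets G" using assms(1) unfolding subalgebra_def by (metis sets.top)
  moreover have "U -` S \<inter> space M = space M \<inter> (U -` S \<inter> space M)" by auto
  ultimately show "U -` S \<inter> space (join_algebra M G N U) \<in> sets (join_algebra M G N U)"
    unfolding sets_join_algebra[OF assms(1)] space_join_algebra[OF assms(1)] using S
    by (intro sigma_sets.Basic) blast
qed (use U assms in \<open>auto dest: measurable_space\<close>)

section \<open>Conditional probabilities given a subalgebra\<close>

lemma prob_subalgebra_imp_sigma_finite:
  assumes "prob_space M" "subalgebra M G"
  shows "sigma_finite_subalgebra M G"
  using assms by (intro finite_measure_subalgebra_is_sigma_finite)
    (simp add: finite_measure_subalgebra_def finite_measure_subalgebra_axioms_def prob_space_def)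

lemma (in finite_measure) integrable_indicator_finite [simp]:
  "A \<in> sets M \<Longrightarrow> integrable M (indicator A :: 'a \<Rightarrow> real)"
  by (rule integrable_real_indicator) (auto simp: less_top[symmetric])

lemma AE_real_cond_exp_indicator_bounds:
  assumes M: "prob_space M" and G: "subalgebra M G" and A: "A \<in> sets M"
  shows "AE \<omega> in M. 0 \<le> real_cond_exp M G (indicator A) \<omega> \<and> real_cond_exp M G (indicator A) \<omega> \<le> 1"
proof -
  interpret prob_space M by fact
  interpret sigma_finite_subalgebra M G by (rule prob_subalgebra_imp_sigma_finite[OF M G])
  have i: "integrable M (indicator A :: _ \<Rightarrow> real)" using A by simp
  have "AE \<omega> in M. 0 \<le> real_cond_exp M G (indicator A) \<omega>"
    by (rule real_cond_exp_ge_c[OF i]) auto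
  moreover have "AE \<omega> in M. real_cond_exp M G (indicator A) \<omega> \<le> 1"
    by (rule real_cond_exp_le_c[OF i]) (auto simp: indicator_def)
  ultimately show ?thesis by auto
qed

lemma integrable_mult_unit_interval:
  fixes f g :: "'w \<Rightarrow> real"
  assumes "integrable M f" "g \<in> borel_measurable M" "AE \<omega> in M. 0 \<le> g \<omega> \<and> g \<omega> \<le> 1"
  shows "integrable M (\<lambda>\<omega>. f \<omega> * g \<omega>)"
proof (rule Bochner_Integration.integrable_bound[OF assms(1)])
  show "AE \<omega> in M. norm (f \<omega> * g \<omega>) \<le> norm (f \<omega>)"
    using assms(3) by eventually_elim (auto simp: abs_mult intro: mult_left_le)
qed (use assms in measurable)

text \<open>The conditional probability \<open>g\<close> given \<open>G\<close> is measurable for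
  the larger algebra as well, so only its integrals over sets of that algebra need checking. On the
  generator they are right by conditional independence, and uniqueness of finite measures carries
  this to all sets.\<close>

lemma real_cond_exp_join_algebra:
  fixes T :: "'w \<Rightarrow> 'b"
  assumes M: "prob_space M" and G: "subalgebra M G"
    and U: "U \<in> measurable M N" and T: "T \<in> measurable M N'"
    and ci: "cond_indep M G N U N' T" and B: "B \<in> sets N'"
  shows "AE \<omega> in M. real_cond_exp M (join_algebra M G N U) (indicator (T -` B \<inter> space M)) \<omega> =
           real_cond_exp M G (indicator (T -` B \<inter> space M)) \<omega>"
proof -
  interpret prob_space M by fact
  interpret G: sigma_finite_subalgebra M G by (rule prob_subalgebra_imp_sigma_finite[OF M G])
  define H where "H = join_algebra M G N U"
  have HM: "subalgebra M H" unfolding H_def by (rule subalgebra_join_algebra[OF G U])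
  have GH: "subalgebra H G" unfolding H_def by (rule subalgebra_of_join_algebra[OF G U])
  interpret H: sigma_finite_subalgebra M H by (rule prob_subalgebra_imp_sigma_finite[OF M HM])
  define TB where "TB = T -` B \<inter> space M"
  have TB [measurable]: "TB \<in> sets M" unfolding TB_def using measurable_sets[OF T B] .
  define g where "g = real_cond_exp M G (indicator TB)"
  have g_meas [measurable]: "g \<in> borel_measurable M" unfolding g_def by simp
  have g_G: "g \<in> borel_measurable G" unfolding g_def by simp
  have g_b: "AE \<omega> in M. 0 \<le> g \<omega> \<and> g \<omega> \<le> 1"
    unfolding g_def by (rule AE_real_cond_exp_indicator_bounds[OF M G TB])
  have g_int: "integrable M g" unfolding g_def by (rule G.real_cond_exp_int) simp
  define E where "E = {c \<inter> (U -` S \<inter> space M) |c S. c \<in> sets G \<and> S \<in> sets N}"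
  have setsH: "sets H = sigma_sets (space M) E" unfolding H_def E_def by (rule sets_join_algebra[OF G])
  have GM: "A \<in> sets M" if "A \<in> sets G" for A using that G unfolding subalgebra_def by auto
  have gen: "(\<integral>\<omega>. g \<omega> * indicator A \<omega> \<partial>M) = measure M (TB \<inter> A)" if "A \<in> E" for A
  proof -
    obtain c S where A: "A = c \<inter> (U -` S \<inter> space M)" and c: "c \<in> sets G" and S: "S \<in> sets N"
      using \<open>A \<in> E\<close> unfolding E_def by blast
    define u where "u = U -` S \<inter> space M"
    have u [measurable]: "u \<in> sets M" unfolding u_def by (rule measurable_sets[OF U S])
    note GM[OF c, measurable]
    have cG: "(indicator c :: _ \<Rightarrow> real) \<in> borel_measurable G" using c by simp
    have uTB: "u \<inter> TB = U -` S \<inter> T -` B \<inter> space M" unfolding u_def TB_def by auto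
    \<comment> \<open>Since \<open>indicator c\<close> times \<open>g\<close> is
      \<open>G\<close>-measurable, \<open>indicator u\<close> may be replaced by its conditional
      expectation. Conditional independence merges this with \<open>g\<close> into the conditional
      probability of \<open>u \<inter> TB\<close>, and the conditioning is then undone.\<close>
    have "(\<integral>\<omega>. g \<omega> * indicator A \<omega> \<partial>M) = (\<integral>\<omega>. (indicator c \<omega> * g \<omega>) * indicator u \<omega> \<partial>M)"
      by (intro Bochner_Integration.integral_cong) (auto simp: A u_def indicator_def)
    also have "\<dots> = (\<integral>\<omega>. (indicator c \<omega> * g \<omega>) * real_cond_exp M G (indicator u) \<omega> \<partial>M)"
    proof (rule G.real_cond_exp_intg(2)[symmetric])
      have "integrable M (\<lambda>\<omega>. g \<omega> * indicator (c \<inter> u) \<omega>)"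
        by (rule integrable_mult_unit_interval[OF g_int]) (auto simp: indicator_def)
      then show "integrable M (\<lambda>\<omega>. (indicator c \<omega> * g \<omega>) * indicator u \<omega>)"
        by (rule Bochner_Integration.integrable_cong[THEN iffD1, rotated 2])
           (auto simp: indicator_def)
    qed (use cG g_G in measurable)
    also have "\<dots> = (\<integral>\<omega>. indicator c \<omega> * real_cond_exp M G (indicator (u \<inter> TB)) \<omega> \<partial>M)"
    proof (rule integral_cong_AE)
      have "AE \<omega> in M. real_cond_exp M G (indicator (u \<inter> TB)) \<omega> =
          real_cond_exp M G (indicator u) \<omega> * g \<omega>"
        using ci S B unfolding uTB unfolding cond_indep_def g_def u_def TB_def by auto
      then show "AE \<omega> in M. indicator c \<omega> * g \<omega> * real_cond_exp M G (indicator u) \<omega> =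
          indicator c \<omega> * real_cond_exp M G (indicator (u \<inter> TB)) \<omega>"
        by eventually_elim simp
    qed measurable
    also have "\<dots> = (\<integral>\<omega>. indicator c \<omega> * indicator (u \<inter> TB) \<omega> \<partial>M)"
      by (rule G.real_cond_exp_intg(2)) (use cG in \<open>auto simp flip: indicator_inter_arith\<close>)
    also have "\<dots> = measure M (TB \<inter> A)"
      by (subst indicator_inter_arith[symmetric]) 
         (use sets.sets_into_space[OF GM[OF c]] in \<open>auto simp: A u_def intro!: arg_cong[where f="measure M"]\<close>)
    finally show ?thesis .
  qed
  \<comment> \<open>Both sides are finite measures in \<open>A\<close>, so agreement on the \<open>\<inter>\<close>-stable generator \<open>E\<close> suffices.\<close>
  let ?m1 = "restr_to_subalg (density M (\<lambda>\<omega>. ennreal (g \<omega>))) H"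
  let ?m2 = "restr_to_subalg (density M (indicator TB)) H"
  have s1: "subalgebra (density M f) H" for f using HM unfolding subalgebra_def by simp
  have e1: "emeasure ?m1 A = ennreal (\<integral>\<omega>. g \<omega> * indicator A \<omega> \<partial>M)" if "A \<in> sets H" for A
  proof -
    have [measurable]: "A \<in> sets M" using that HM unfolding subalgebra_def by auto
    have "emeasure ?m1 A = (\<integral>\<^sup>+\<omega>. ennreal (g \<omega>) * indicator A \<omega> \<partial>M)"
      by (simp add: emeasure_restr_to_subalg[OF s1 that] emeasure_density)
    also have "\<dots> = (\<integral>\<^sup>+\<omega>. ennreal (g \<omega> * indicator A \<omega>) \<partial>M)"
      by (intro nn_integral_cong) (auto simp: indicator_def)
    also have "\<dots> = ennreal (\<integral>\<omega>. g \<omega> * indicator A \<omega> \<partial>M)"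
    proof (rule nn_integral_eq_integral)
      show "integrable M (\<lambda>\<omega>. g \<omega> * indicator A \<omega>)"
        by (rule integrable_mult_unit_interval[OF g_int]) (auto simp: indicator_def)
      show "AE \<omega> in M. 0 \<le> g \<omega> * indicator A \<omega>" using g_b by eventually_elim simp
    qed
    finally show ?thesis .
  qed
  have e2: "emeasure ?m2 A = ennreal (measure M (TB \<inter> A))" if "A \<in> sets H" for A
  proof -
    have [measurable]: "A \<in> sets M" using that HM unfolding subalgebra_def by auto
    show ?thesis
      by (simp add: emeasure_restr_to_subalg[OF s1 that] emeasure_density emeasure_eq_measure
          flip: indicator_inter_arith)
  qed
  have EH: "A \<in> sets H" if "A \<in> E" for A using that unfolding setsH by (rule sigma_sets.Basic)
  have "?m1 = ?m2"
  proof (rule measure_eqI_generator_eq)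
    show "Int_stable E"
      unfolding Int_stable_def
    proof safe
      fix a b assume "a \<in> E" "b \<in> E"
      then obtain c S c' S' where "a = c \<inter> (U -` S \<inter> space M)" "c \<in> sets G" "S \<in> sets N"
        "b = c' \<inter> (U -` S' \<inter> space M)" "c' \<in> sets G" "S' \<in> sets N" unfolding E_def by blast
      moreover from this have "a \<inter> b = (c \<inter> c') \<inter> (U -` (S \<inter> S') \<inter> space M)" by auto
      ultimately show "a \<inter> b \<in> E" unfolding E_def by blast
    qed
    show "E \<subseteq> Pow (space M)" unfolding E_def by auto
    show "emeasure ?m1 A = emeasure ?m2 A" if "A \<in> E" for A
      using e1[OF EH[OF that]] e2[OF EH[OF that]] gen[OF that] by simp
    show "sets ?m1 = sigma_sets (space M) E" "sets ?m2 = sigma_sets (space M) E"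
      by (simp_all add: sets_restr_to_subalg[OF s1] setsH)
    have "space M \<in> E"
    proof -
      have "space M = space M \<inter> (U -` space N \<inter> space M)" using measurable_space[OF U] by auto
      moreover have "space M \<in> sets G" using G unfolding subalgebra_def by (metis sets.top)
      ultimately show ?thesis unfolding E_def by blast
    qed
    then show "range (\<lambda>i::nat. space M) \<subseteq> E" by auto
    show "emeasure ?m1 (space M) \<noteq> \<infinity>" for i :: nat
      using e1[OF EH[OF \<open>space M \<in> E\<close>]] by simp
  qed auto
  then have eq: "ennreal (\<integral>\<omega>. g \<omega> * indicator A \<omega> \<partial>M) = ennreal (measure M (TB \<inter> A))"
    if "A \<in> sets H" for A
    using e1[OF that] e2[OF that] by simp
  have "AE \<omega> in M. real_cond_exp M H (indicator TB) \<omega> = g \<omega>"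
  proof (rule H.real_cond_exp_charact)
    fix A assume A: "A \<in> sets H"
    have [measurable]: "A \<in> sets M" using A HM unfolding subalgebra_def by auto
    \<comment> \<open>\<open>ennreal\<close> sends every negative real to 0, so \<open>eq\<close>
      yields an equality of reals only once the integral is known to be nonnegative.\<close>
    have "AE \<omega> in M. 0 \<le> g \<omega> * indicator A \<omega>" using g_b by eventually_elim simp
    then have "0 \<le> (\<integral>\<omega>. g \<omega> * indicator A \<omega> \<partial>M)" by (rule integral_nonneg_AE)
    then have "(\<integral>\<omega>. g \<omega> * indicator A \<omega> \<partial>M) = measure M (TB \<inter> A)"
      using eq[OF A] by (simp add: ennreal_inj)
    then show "(\<integral>\<omega>\<in>A. indicator TB \<omega> \<partial>M) = (\<integral>\<omega>\<in>A. g \<omega> \<partial>M)"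
      unfolding set_lebesgue_integral_def
      by (simp add: mult.commute Int_commute flip: indicator_inter_arith)
  qed (use g_int measurable_from_subalg[OF GH g_G] in auto)
  then show ?thesis unfolding H_def g_def TB_def .
qed

text \<open>Condition in two stages. Given the joined algebra, \<open>A\<close> is known and the
  probability of the \<open>T\<close>-event is the one given \<open>G\<close>. Conditioning then on
  \<open>G\<close>, this probability is the factor that can be pulled out.\<close>

lemma cond_indep_join_algebra:
  fixes T :: "'w \<Rightarrow> 'b"
  assumes M: "prob_space M" and G: "subalgebra M G"
    and U: "U \<in> measurable M N" and T: "T \<in> measurable M N'"
    and ci: "cond_indep M G N U N' T" and B: "B \<in> sets N'"
    and A: "A \<in> sets (join_algebra M G N U)"
  shows "AE \<omega> in M. real_cond_exp M G (indicator (A \<inter> (T -` B \<inter> space M))) \<omega> =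
           real_cond_exp M G (indicator A) \<omega> * real_cond_exp M G (indicator (T -` B \<inter> space M)) \<omega>"
proof -
  interpret prob_space M by fact
  interpret G: sigma_finite_subalgebra M G by (rule prob_subalgebra_imp_sigma_finite[OF M G])
  define H where "H = join_algebra M G N U"
  have HM: "subalgebra M H" unfolding H_def by (rule subalgebra_join_algebra[OF G U])
  have GH: "subalgebra H G" unfolding H_def by (rule subalgebra_of_join_algebra[OF G U])
  interpret H: sigma_finite_subalgebra M H by (rule prob_subalgebra_imp_sigma_finite[OF M HM])
  define TB where "TB = T -` B \<inter> space M"
  have TB [measurable]: "TB \<in> sets M" unfolding TB_def using measurable_sets[OF T B] .
  have AH: "A \<in> sets H" using A unfolding H_def .
  then have [measurable]: "A \<in> sets M" using HM unfolding subalgebra_def by auto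
  let ?g = "real_cond_exp M G (indicator TB)"
  have g_b: "AE \<omega> in M. 0 \<le> ?g \<omega> \<and> ?g \<omega> \<le> 1"
    by (rule AE_real_cond_exp_indicator_bounds[OF M G TB])
  have gA: "integrable M (\<lambda>\<omega>. indicator A \<omega> * ?g \<omega>)"
    by (rule integrable_mult_unit_interval[OF _ _ g_b]) auto
  have "AE \<omega> in M. real_cond_exp M H (\<lambda>\<omega>. indicator A \<omega> * indicator TB \<omega>) \<omega> =
      indicator A \<omega> * real_cond_exp M H (indicator TB) \<omega>"
    by (rule H.real_cond_exp_mult) (use AH in \<open>auto simp flip: indicator_inter_arith\<close>)
  moreover have "AE \<omega> in M. real_cond_exp M H (indicator TB) \<omega> = ?g \<omega>"
    unfolding H_def TB_def by (rule real_cond_exp_join_algebra[OF M G U T ci B])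
  ultimately have "AE \<omega> in M. real_cond_exp M H (\<lambda>\<omega>. indicator A \<omega> * indicator TB \<omega>) \<omega> =
      indicator A \<omega> * ?g \<omega>"
    by eventually_elim simp
  \<comment> \<open>Both sides are conditioned on \<open>G\<close>: the tower property removes
    \<open>H\<close> on the left, and on the right the \<open>G\<close>-measurable factor comes
    out.\<close>
  then have "AE \<omega> in M. real_cond_exp M G (real_cond_exp M H (\<lambda>\<omega>. indicator A \<omega> * indicator TB \<omega>)) \<omega> =
      real_cond_exp M G (\<lambda>\<omega>. indicator A \<omega> * ?g \<omega>) \<omega>"
    by (rule G.real_cond_exp_cong) auto
  moreover have "AE \<omega> in M. real_cond_exp M G (real_cond_exp M H (\<lambda>\<omega>. indicator A \<omega> * indicator TB \<omega>)) \<omega> =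
      real_cond_exp M G (\<lambda>\<omega>. indicator A \<omega> * indicator TB \<omega>) \<omega>"
    by (rule G.real_cond_exp_nested_subalg[OF HM GH]) (auto simp flip: indicator_inter_arith)
  moreover have "AE \<omega> in M. real_cond_exp M G (\<lambda>\<omega>. ?g \<omega> * indicator A \<omega>) \<omega> =
      ?g \<omega> * real_cond_exp M G (indicator A) \<omega>"
    by (rule G.real_cond_exp_mult) (use gA in \<open>auto simp: mult.commute\<close>)
  ultimately have "AE \<omega> in M. real_cond_exp M G (\<lambda>\<omega>. indicator A \<omega> * indicator TB \<omega>) \<omega> =
      real_cond_exp M G (indicator A) \<omega> * ?g \<omega>"
    by eventually_elim (simp add: mult.commute)
  then show ?thesis unfolding TB_def[symmetric] by (simp flip: indicator_inter_arith)
qed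



section \<open>Responses to an extreme value\<close>

text \<open>This keeps the unrolled recursion measurable at a fixed value of the extreme variable:
  \<open>h\<close> becomes a continuous function of real sequences after relabelling its
  coordinates.\<close>

lemma borel_measurable_continuous_powertop_real:
  assumes J: "countable J" and h: "continuous_map (powertop_real J) euclideanreal h"
    and f: "\<And>j. j \<in> J \<Longrightarrow> f j \<in> borel_measurable M"
  shows "(\<lambda>\<omega>. h (\<lambda>j\<in>J. f j \<omega>)) \<in> borel_measurable M"
proof -
  \<comment> \<open>Reindexing by \<open>nat\<close> because Borel measurability into a function space is only available
    for a countable index type.\<close>
  define g :: "(nat \<Rightarrow> real) \<Rightarrow> 'a \<Rightarrow> real" where "g = (\<lambda>u. \<lambda>j\<in>J. u (to_nat_on J j))"
  \<comment> \<open>The default 0 is never read: \<open>g\<close> only looks at the indices in the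
    image of \<open>J\<close>.\<close>
  define F where "F = (\<lambda>\<omega> n. if n \<in> to_nat_on J ` J then f (from_nat_into J n) \<omega> else 0)"
  have "continuous_map euclidean (powertop_real J) g"
    unfolding g_def continuous_map_componentwise
    by (auto simp flip: euclidean_product_topology intro!: continuous_map_product_projection)
  then have "continuous_map euclidean euclideanreal (h \<circ> g)"
    using h by (rule continuous_map_compose)
  then have hg: "h \<circ> g \<in> borel_measurable borel"
    by (intro borel_measurable_continuous_onI) simp
  have "F \<in> borel_measurable M"
  proof (rule measurable_coordinatewise_then_product)
    fix n show "(\<lambda>\<omega>. F \<omega> n) \<in> borel_measurable M"
      unfolding F_def using f J by (cases "n \<in> to_nat_on J ` J") auto
  qed
  then have "(\<lambda>\<omega>. (h \<circ> g) (F \<omega>)) \<in> borel_measurable M"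
    using hg by (rule measurable_compose)
  moreover have "g (F \<omega>) = (\<lambda>j\<in>J. f j \<omega>)" for \<omega>
    unfolding g_def F_def using J by (auto simp: fun_eq_iff)
  ultimately show ?thesis by simp
qed

text \<open>The value of \<open>T\<close> becomes a free parameter \<open>x\<close>, and all
  remaining randomness lies in \<open>H\<close>. Only the identity with \<open>V\<close> is almost
  sure, as the structural equations are. The final dichotomy takes the same branch for every
  \<omega>, so that it can be passed through a further function.\<close>

definition tail_response :: "'w measure \<Rightarrow> 'w measure \<Rightarrow> ('w \<Rightarrow> real) \<Rightarrow> ('w \<Rightarrow> real) \<Rightarrow> (real \<Rightarrow> 'w \<Rightarrow> real) \<Rightarrow> bool"
  where "tail_response M H T V \<phi> \<longleftrightarrow>
     (\<forall>x. \<phi> x \<in> borel_measurable H) \<and>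
     (\<forall>\<omega>. continuous_on UNIV (\<lambda>x. \<phi> x \<omega>)) \<and>
     (AE \<omega> in M. V \<omega> = \<phi> (T \<omega>) \<omega>) \<and>
     ((\<forall>\<omega> x y. \<phi> x \<omega> = \<phi> y \<omega>) \<or> (\<forall>\<omega>. filterlim (\<lambda>x. \<phi> x \<omega>) at_top at_top))"

lemma tail_response_const:
  "V \<in> borel_measurable H \<Longrightarrow> tail_response M H T V (\<lambda>_. V)"
  unfolding tail_response_def by auto

lemma tail_response_self: "tail_response M H T T (\<lambda>x _. x)"
  unfolding tail_response_def by (auto simp: filterlim_ident)

text \<open>Let \<open>I\<close> collect the inputs that diverge with \<open>x\<close>; the others
  do not move. If \<open>h\<close> is constant in the coordinates \<open>I\<close>, the output does
  not move either. Otherwise upper-tail preservation for \<open>I\<close>, with a one-point compact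
  set for the fixed inputs, makes the output diverge.\<close>

lemma tail_response_compose:
  assumes J: "finite J" and h: "upper_tail_preserving J h"
    and V: "\<And>j. j \<in> J \<Longrightarrow> \<exists>\<phi>. tail_response M H T (V j) \<phi>"
    and W: "AE \<omega> in M. W \<omega> = h (\<lambda>j\<in>J. V j \<omega>)"
  shows "\<exists>\<phi>. tail_response M H T W \<phi>"
proof -
  obtain \<psi> where \<psi>: "\<And>j. j \<in> J \<Longrightarrow> tail_response M H T (V j) (\<psi> j)"
    using V by metis
  have cont: "continuous_map (powertop_real J) euclideanreal h"
    using h unfolding upper_tail_preserving_def by blast
  define \<Psi> where "\<Psi> = (\<lambda>x \<omega>. \<lambda>j\<in>J. \<psi> j x \<omega>)"
  have top: "\<Psi> x \<omega> \<in> topspace (powertop_real J)" for x \<omega> unfolding \<Psi>_def by auto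
  have "tail_response M H T W (\<lambda>x \<omega>. h (\<Psi> x \<omega>))"
    unfolding tail_response_def
  proof (intro conjI allI)
    fix x show "(\<lambda>\<omega>. h (\<Psi> x \<omega>)) \<in> borel_measurable H"
      unfolding \<Psi>_def using J cont \<psi>
      by (intro borel_measurable_continuous_powertop_real)
         (auto simp: countable_finite tail_response_def)
  next
    fix \<omega>
    have "continuous_map euclideanreal (powertop_real J) (\<lambda>x. \<Psi> x \<omega>)"
      unfolding \<Psi>_def continuous_map_componentwise
      using \<psi> by (auto simp: tail_response_def)
    from continuous_map_compose[OF this cont]
    show "continuous_on UNIV (\<lambda>x. h (\<Psi> x \<omega>))" by (simp add: o_def)
  next
    have "AE \<omega> in M. \<forall>j\<in>J. V j \<omega> = \<psi> j (T \<omega>) \<omega>"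
      using \<psi> J by (intro AE_finite_allI) (auto simp: tail_response_def)
    with W show "AE \<omega> in M. W \<omega> = h (\<Psi> (T \<omega>) \<omega>)"
    proof eventually_elim
      case (elim \<omega>)
      then have "(\<lambda>j\<in>J. V j \<omega>) = \<Psi> (T \<omega>) \<omega>" unfolding \<Psi>_def by auto
      with elim show ?case by simp
    qed
  next
    \<comment> \<open>As the dichotomy is uniform in \<omega>, one set \<open>I\<close> serves all
      \<omega>: each input outside it is independent of \<open>x\<close>, and each input inside it
      diverges at every \<omega>.\<close>
    define I where "I = {j\<in>J. \<not> (\<forall>\<omega> x y. \<psi> j x \<omega> = \<psi> j y \<omega>)}"
    have agree: "\<Psi> x \<omega> j = \<Psi> y \<omega> j" if "j \<in> J - I" for x y \<omega> j
    proof -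
      have "\<psi> j x \<omega> = \<psi> j y \<omega>" using that unfolding I_def by blast
      then show ?thesis using that by (simp add: \<Psi>_def)
    qed
    have lim: "filterlim (\<lambda>x. \<psi> j x \<omega>) at_top at_top" if "j \<in> I" for j \<omega>
      using that \<psi>[of j] unfolding I_def tail_response_def by blast
    show "(\<forall>\<omega> x y. h (\<Psi> x \<omega>) = h (\<Psi> y \<omega>)) \<or> (\<forall>\<omega>. filterlim (\<lambda>x. h (\<Psi> x \<omega>)) at_top at_top)"
    proof (cases "constant_in_coords J I h")
      case True
      then have "h (\<Psi> x \<omega>) = h (\<Psi> y \<omega>)" for x y \<omega>
        using agree top unfolding constant_in_coords_def by blast
      then show ?thesis by blast
    next
      case False
      \<comment> \<open>Upper-tail preservation speaks of nonempty sets only. For empty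
        \<open>I\<close>, points agreeing on \<open>J - I\<close> are equal, so \<open>h\<close>
        would count as constant.\<close>
      then have "I \<noteq> {}"
      proof (rule contrapos_nn)
        assume "I = {}"
        have "x = y" if "x \<in> topspace (powertop_real J)" "y \<in> topspace (powertop_real J)"
            "\<forall>j\<in>J - I. x j = y j" for x y
          using that \<open>I = {}\<close> by (intro extensionalityI[of _ J]) (auto simp: PiE_def)
        then show "constant_in_coords J I h" unfolding constant_in_coords_def by blast
      qed
      moreover have "I \<subseteq> J" unfolding I_def by blast
      ultimately have tail: "\<forall>K. compactin (powertop_real (J - I)) K \<longrightarrow>
           ((\<lambda>r::real. INF x \<in> {x \<in> topspace (powertop_real J).
                (\<forall>i\<in>I. r \<le> x i) \<and> restrict x (J - I) \<in> K}. ereal (h x)) \<longlongrightarrow> \<infinity>) at_top"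
        using h False unfolding upper_tail_preserving_def by blast
      have "filterlim (\<lambda>x. h (\<Psi> x \<omega>)) at_top at_top" for \<omega>
        unfolding filterlim_at_top
      proof
        fix b :: real
        \<comment> \<open>The inputs outside \<open>I\<close> are the same for all \<open>x\<close>,
          so evaluating them at the arbitrary point 0 gives their value throughout.\<close>
        define k where "k = restrict (\<Psi> 0 \<omega>) (J - I)"
        have "compactin (powertop_real (J - I)) {k}"
          unfolding k_def by (intro finite_imp_compactin) auto
        with tail have "((\<lambda>r::real. INF x \<in> {x \<in> topspace (powertop_real J).
                (\<forall>i\<in>I. r \<le> x i) \<and> restrict x (J - I) \<in> {k}}. ereal (h x)) \<longlongrightarrow> \<infinity>) at_top"
          by blast
        then have "\<forall>\<^sub>F r in at_top. ereal b < (INF x \<in> {x \<in> topspace (powertop_real J).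
                (\<forall>i\<in>I. r \<le> x i) \<and> restrict x (J - I) \<in> {k}}. ereal (h x))"
          by (rule order_tendstoD) simp
        \<comment> \<open>A single threshold suffices: the finitely many inputs in \<open>I\<close>
          eventually all exceed \<open>r\<close>, and from then on the infimum bounds the output
          from below.\<close>
        then obtain r where r: "ereal b < (INF x \<in> {x \<in> topspace (powertop_real J).
                (\<forall>i\<in>I. r \<le> x i) \<and> restrict x (J - I) \<in> {k}}. ereal (h x))"
          using eventually_happens trivial_limit_at_top_linorder by blast
        have "\<forall>\<^sub>F x in at_top. \<forall>i\<in>I. r \<le> \<psi> i x \<omega>"
          using finite_subset[OF \<open>I \<subseteq> J\<close> J] lim
          by (intro eventually_ball_finite) (auto simp: filterlim_at_top)
        then show "\<forall>\<^sub>F x in at_top. b \<le> h (\<Psi> x \<omega>)"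
        proof eventually_elim
          case (elim x)
          have "restrict (\<Psi> x \<omega>) (J - I) = k"
            unfolding k_def using agree by (intro restrict_ext) blast
          moreover have "\<forall>i\<in>I. r \<le> \<Psi> x \<omega> i"
            using elim \<open>I \<subseteq> J\<close> by (auto simp: \<Psi>_def)
          ultimately have "(INF x \<in> {x \<in> topspace (powertop_real J).
                (\<forall>i\<in>I. r \<le> x i) \<and> restrict x (J - I) \<in> {k}}. ereal (h x)) \<le> ereal (h (\<Psi> x \<omega>))"
            using top by (intro INF_lower) auto
          with r have "ereal b < ereal (h (\<Psi> x \<omega>))" by (rule less_le_trans)
          then show ?case by simp
        qed
      qed
      then show ?thesis by blast
    qed
  qed
  then show ?thesis by blast
qed


section \<open>The conditional tail limit\<close>

text \<open>The conditional probabilities increase almost surely to some \<open>L\<close> with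
  values in the unit interval. By dominated convergence its integral is the limit of the
  probabilities of \<open>A n\<close>, which is 1, so the nonnegative variable \<open>1 - L\<close>
  has integral 0 and vanishes almost surely.\<close>

lemma AE_real_cond_exp_incseq_tendsto_1:
  assumes M: "prob_space M" and G: "subalgebra M G"
    and A: "\<And>n. A n \<in> sets M" and inc: "incseq A" and un: "(\<Union>n. A n) = space M"
  shows "AE \<omega> in M. (\<lambda>n. real_cond_exp M G (indicator (A n)) \<omega>) \<longlonglongrightarrow> 1"
proof -
  interpret prob_space M by fact
  interpret G: sigma_finite_subalgebra M G by (rule prob_subalgebra_imp_sigma_finite[OF M G])
  note A [measurable]
  define r where "r = (\<lambda>n. real_cond_exp M G (indicator (A n)))"
  have [measurable]: "r n \<in> borel_measurable M" for n unfolding r_def by simp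
  \<comment> \<open>\<open>lim\<close> is total, so \<open>L\<close> is a measurable function before
    convergence, which holds only almost surely, is established.\<close>
  define L where "L = (\<lambda>\<omega>. lim (\<lambda>n. r n \<omega>))"
  have [measurable]: "L \<in> borel_measurable M" unfolding L_def by measurable
  have b: "AE \<omega> in M. \<forall>n. 0 \<le> r n \<omega> \<and> r n \<omega> \<le> 1"
    unfolding AE_all_countable r_def
    using AE_real_cond_exp_indicator_bounds[OF M G A] by blast
  have mono: "AE \<omega> in M. \<forall>n. r n \<omega> \<le> r (Suc n) \<omega>"
    unfolding AE_all_countable r_def
  proof
    fix n
    have "A n \<subseteq> A (Suc n)" using inc by (simp add: incseq_Suc_iff)
    then show "AE \<omega> in M. real_cond_exp M G (indicator (A n)) \<omega> \<le> real_cond_exp M G (indicator (A (Suc n))) \<omega>"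
      by (intro G.real_cond_exp_mono) (auto simp: indicator_def)
  qed
  have L: "AE \<omega> in M. (\<lambda>n. r n \<omega>) \<longlonglongrightarrow> L \<omega>"
    using b mono
  proof eventually_elim
    case (elim \<omega>)
    then have "convergent (\<lambda>n. r n \<omega>)"
      by (intro Bseq_mono_convergent BseqI'[where K = 1]) (auto intro: lift_Suc_mono_le)
    then show ?case unfolding L_def by (simp add: convergent_LIMSEQ_iff)
  qed
  have L1: "AE \<omega> in M. L \<omega> \<le> 1" and L0: "AE \<omega> in M. 0 \<le> L \<omega>"
    using b L by (eventually_elim, blast intro: LIMSEQ_le_const2 LIMSEQ_le_const)+
  have "(\<lambda>n. \<integral>\<omega>. r n \<omega> \<partial>M) \<longlonglongrightarrow> (\<integral>\<omega>. L \<omega> \<partial>M)"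
  proof (rule integral_dominated_convergence[where w = "\<lambda>_. 1"])
    show "AE \<omega> in M. norm (r n \<omega>) \<le> 1" for n using b by eventually_elim auto
  qed (use L in auto)
  moreover have "(\<integral>\<omega>. r n \<omega> \<partial>M) = measure M (A n)" for n
    unfolding r_def using G.real_cond_exp_int(2)[of "indicator (A n)"] by simp
  moreover have "(\<lambda>n. measure M (A n)) \<longlonglongrightarrow> 1"
    using finite_Lim_measure_incseq[OF _ inc] A by (auto simp: un prob_space image_subset_iff)
  ultimately have "(\<integral>\<omega>. L \<omega> \<partial>M) = 1" using LIMSEQ_unique by auto
  moreover have "integrable M L"
    using L0 L1 by (intro integrable_const_bound[where B = 1]) auto
  ultimately have "(\<integral>\<omega>. 1 - L \<omega> \<partial>M) = 0" "integrable M (\<lambda>\<omega>. 1 - L \<omega>)"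
    using prob_space by simp_all
  moreover have "AE \<omega> in M. 0 \<le> 1 - L \<omega>" using L1 by eventually_elim simp
  ultimately have "AE \<omega> in M. 1 - L \<omega> = 0"
    using integral_nonneg_eq_0_iff_AE by blast
  with L show ?thesis unfolding r_def by eventually_elim simp
qed

text \<open>\<open>W\<close> will be the maximum over the horizon, squeezed between \<open>F\<close>
  at the diverging variable and 1. The conditional expectation is squeezed accordingly between
  \<open>F (real k)\<close> times the conditional probability of \<open>A k n\<close> and 1.\<close>

lemma cond_exp_exceed_limit_tail_response:
  fixes T V W :: "'w \<Rightarrow> real" and F :: "real \<Rightarrow> real"
  assumes M: "prob_space M" and G: "subalgebra M G"
    and U: "U \<in> measurable M N" and T: "T \<in> borel_measurable M"
    and ci: "cond_indep M G N U borel T"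
    and \<phi>: "tail_response M (join_algebra M G N U) T V \<phi>"
    and lim: "\<And>\<omega>. filterlim (\<lambda>x. \<phi> x \<omega>) at_top at_top"
    and F: "mono F" "\<And>x. 0 \<le> F x" "(F \<longlongrightarrow> 1) at_top"
    and W: "W \<in> borel_measurable M" "\<And>\<omega>. W \<omega> \<le> 1" "\<And>\<omega>. F (V \<omega>) \<le> W \<omega>"
    and pos: "\<And>v. AE \<omega> in M. 0 < cond_prob_exceed M G T v \<omega>"
  shows "cond_exp_exceed_limit M G T W (\<lambda>_. 1)"
  unfolding cond_exp_exceed_limit_def
proof (intro allI impI)
  fix Q :: "real set" assume Q: "countable Q"
  interpret prob_space M by fact
  interpret G: sigma_finite_subalgebra M G by (rule prob_subalgebra_imp_sigma_finite[OF M G])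
  define H where "H = join_algebra M G N U"
  have HM: "subalgebra M H" unfolding H_def by (rule subalgebra_join_algebra[OF G U])
  have \<phi>_meas [measurable]: "\<phi> x \<in> borel_measurable H" for x
    using \<phi> unfolding tail_response_def H_def by blast
  have \<phi>_cont: "continuous_on UNIV (\<lambda>x. \<phi> x \<omega>)" for \<omega>
    using \<phi> unfolding tail_response_def by blast
  have V_eq: "AE \<omega> in M. V \<omega> = \<phi> (T \<omega>) \<omega>"
    using \<phi> unfolding tail_response_def by blast
  have W0: "0 \<le> W \<omega>" for \<omega> using F(2) W(3) order_trans by blast
  note T [measurable] W(1) [measurable]
  \<comment> \<open>Only rational \<open>x\<close>, for measurability; continuity in \<open>x\<close> gives the bound for all real \<open>x > n\<close>.\<close>
  define A where "A = (\<lambda>k n. {\<omega> \<in> space H. \<forall>x\<in>\<rat>. real n < x \<longrightarrow> real k \<le> \<phi> x \<omega>})"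
  have A_H: "A k n \<in> sets H" for k n
    unfolding A_def using countable_rat by measurable
  then have A_M [measurable]: "A k n \<in> sets M" for k n using HM unfolding subalgebra_def by blast
  have space_H: "space H = space M" using HM unfolding subalgebra_def by blast
  have A_D: "real k \<le> \<phi> x \<omega>" if "\<omega> \<in> A k n" "real n < x" for k n x \<omega>
  proof (rule ccontr)
    assume "\<not> real k \<le> \<phi> x \<omega>"
    moreover have "open {y. \<phi> y \<omega> < real k}"
      by (intro open_Collect_less \<phi>_cont continuous_on_const)
    ultimately obtain e where e: "e > 0" "ball x e \<subseteq> {y. \<phi> y \<omega> < real k}"
      by (metis (mono_tags, lifting) mem_Collect_eq not_le openE)
    \<comment> \<open>The rational is taken to the right of \<open>x\<close>, so that it still
      exceeds \<open>n\<close>.\<close>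
    obtain q where q: "q \<in> \<rat>" "x < q" "q < x + e" using Rats_dense_in_real[of x "x + e"] e by auto
    then have "q \<in> ball x e" by (simp add: dist_real_def)
    then have "\<phi> q \<omega> < real k" using e(2) by blast
    moreover have "real k \<le> \<phi> q \<omega>" using that q unfolding A_def by auto
    ultimately show False by simp
  qed
  have A_tendsto: "AE \<omega> in M. \<forall>k. (\<lambda>n. real_cond_exp M G (indicator (A k n)) \<omega>) \<longlonglongrightarrow> 1"
    unfolding AE_all_countable
  proof
    fix k
    show "AE \<omega> in M. (\<lambda>n. real_cond_exp M G (indicator (A k n)) \<omega>) \<longlonglongrightarrow> 1"
    proof (rule AE_real_cond_exp_incseq_tendsto_1[OF M G A_M])
      show "incseq (A k)" unfolding incseq_def A_def by force
      have "\<exists>n. \<omega> \<in> A k n" if "\<omega> \<in> space M" for \<omega>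
      proof -
        obtain b where "\<And>x. b \<le> x \<Longrightarrow> real k \<le> \<phi> x \<omega>"
          using lim[of \<omega>] unfolding filterlim_at_top eventually_at_top_linorder by blast
        moreover obtain n where "b \<le> real n" using real_arch_simple by blast
        ultimately have "\<omega> \<in> A k n" using that unfolding A_def space_H by force
        then show ?thesis ..
      qed
      then show "(\<Union>n. A k n) = space M" unfolding A_def space_H by blast
    qed
  qed
  have lower: "AE \<omega> in M. F (real k) * real_cond_exp M G (indicator (A k n)) \<omega> \<le> cond_exp_exceed M G T v W \<omega>"
    if "real n \<le> v" for k n v
  proof -
    define S where "S = T -` {v<..} \<inter> space M"
    have S_eq: "{\<omega> \<in> space M. v < T \<omega>} = S" unfolding S_def by auto
    have [measurable]: "S \<in> sets M" unfolding S_def by measurable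
    \<comment> \<open>On \<open>A k n \<inter> S\<close> one has
      \<open>T \<omega> > v \<ge> n\<close>, hence \<open>V \<omega> \<ge> k\<close>; elsewhere the
      left side is 0 and the right side is nonnegative.\<close>
    have "AE \<omega> in M. F (real k) * indicator (A k n \<inter> S) \<omega> \<le> W \<omega> * indicator S \<omega>"
      using V_eq
    proof eventually_elim
      case (elim \<omega>)
      show ?case
      proof (cases "\<omega> \<in> A k n \<inter> S")
        case True
        then have "real k \<le> V \<omega>" using A_D[of \<omega> k n "T \<omega>"] that elim unfolding S_def by auto
        then have "F (real k) \<le> W \<omega>" using monoD[OF F(1)] W(3) order_trans by blast
        then show ?thesis using True by simp
      qed (use W0 in \<open>auto simp: indicator_def\<close>)
    qed
    then have "AE \<omega> in M. real_cond_exp M G (\<lambda>\<omega>. F (real k) * indicator (A k n \<inter> S) \<omega>) \<omega> \<le>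
        real_cond_exp M G (\<lambda>\<omega>. W \<omega> * indicator S \<omega>) \<omega>"
    proof (rule G.real_cond_exp_mono)
      show "integrable M (\<lambda>\<omega>. W \<omega> * indicator S \<omega>)"
        using W0 W(2) by (intro integrable_const_bound[where B = 1]) (auto simp: indicator_def)
    qed simp
    moreover have "AE \<omega> in M. real_cond_exp M G (\<lambda>\<omega>. F (real k) * indicator (A k n \<inter> S) \<omega>) \<omega> =
        F (real k) * real_cond_exp M G (indicator (A k n \<inter> S)) \<omega>"
      by (rule G.real_cond_exp_cmult) simp
    \<comment> \<open>Since \<open>A k n\<close> lies in \<open>H\<close>, its conditional
      probability splits off, and the positive conditional probability of \<open>S\<close> cancels
      in the quotient.\<close>
    moreover have "AE \<omega> in M. real_cond_exp M G (indicator (A k n \<inter> S)) \<omega> =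
        real_cond_exp M G (indicator (A k n)) \<omega> * real_cond_exp M G (indicator S) \<omega>"
      unfolding S_def using A_H unfolding H_def
      by (intro cond_indep_join_algebra[OF M G U T ci]) auto
    moreover have "AE \<omega> in M. 0 < real_cond_exp M G (indicator S) \<omega>"
      using pos[of v] unfolding cond_prob_exceed_def S_eq .
    ultimately show ?thesis
      unfolding cond_exp_exceed_def cond_prob_exceed_def S_eq
      by eventually_elim (simp add: pos_le_divide_eq)
  qed
  have upper: "AE \<omega> in M. cond_exp_exceed M G T v W \<omega> \<le> 1" for v
  proof -
    define S where "S = {\<omega> \<in> space M. v < T \<omega>}"
    have [measurable]: "S \<in> sets M" unfolding S_def by measurable
    have "AE \<omega> in M. real_cond_exp M G (\<lambda>\<omega>. W \<omega> * indicator S \<omega>) \<omega> \<le> real_cond_exp M G (indicator S) \<omega>"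
    proof (rule G.real_cond_exp_mono)
      show "integrable M (\<lambda>\<omega>. W \<omega> * indicator S \<omega>)"
        using W0 W(2) by (intro integrable_const_bound[where B = 1]) (auto simp: indicator_def)
    qed (use W(2) in \<open>auto simp: indicator_def\<close>)
    then show ?thesis
      using pos[of v] unfolding cond_exp_exceed_def cond_prob_exceed_def S_def[symmetric]
      by eventually_elim simp
  qed
  \<comment> \<open>Countability of \<open>Q\<close> and of the pairs \<open>k\<close>,
    \<open>n\<close> merges the exceptional sets into a single null set.\<close>
  have "AE \<omega> in M. \<forall>v\<in>Q. \<forall>k n. real n \<le> v \<longrightarrow>
      F (real k) * real_cond_exp M G (indicator (A k n)) \<omega> \<le> cond_exp_exceed M G T v W \<omega>"
    using lower by (auto simp: AE_ball_countable[OF Q] AE_all_countable)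
  moreover have "AE \<omega> in M. \<forall>v\<in>Q. cond_exp_exceed M G T v W \<omega> \<le> 1"
    using upper by (simp add: AE_ball_countable[OF Q])
  ultimately show "AE \<omega> in M. ((\<lambda>v. cond_exp_exceed M G T v W \<omega>) \<longlongrightarrow> 1) (inf at_top (principal Q))"
    using A_tendsto
  proof eventually_elim
    case (elim \<omega>)
    show ?case
    proof (rule order_tendstoI)
      fix a :: real assume "1 < a"
      then show "\<forall>\<^sub>F v in inf at_top (principal Q). cond_exp_exceed M G T v W \<omega> < a"
        unfolding eventually_inf_principal using elim(2) by (auto intro!: always_eventually)
    next
      fix a :: real assume "a < 1"
      \<comment> \<open>First \<open>k\<close> is chosen so that \<open>F (real k)\<close> exceeds
        \<open>a\<close>, then \<open>n\<close> so that multiplying by the conditional probability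
        keeps it above \<open>a\<close>. All levels \<open>v \<ge> n\<close> in \<open>Q\<close>
        then work.\<close>
      have "(\<lambda>k. F (real k)) \<longlonglongrightarrow> 1"
        using F(3) filterlim_real_sequentially by (rule filterlim_compose)
      then obtain k where k: "a < F (real k)"
        using order_tendstoD(1)[OF _ \<open>a < 1\<close>] eventually_happens trivial_limit_sequentially by blast
      have "(\<lambda>n. F (real k) * real_cond_exp M G (indicator (A k n)) \<omega>) \<longlonglongrightarrow> F (real k) * 1"
        using elim(3) by (intro tendsto_mult_left) blast
      then obtain n where n: "a < F (real k) * real_cond_exp M G (indicator (A k n)) \<omega>"
        using order_tendstoD(1)[of _ "F (real k) * 1" _ a] k eventually_happens trivial_limit_sequentially
        by (metis (no_types, lifting) mult.right_neutral)
      have "\<forall>\<^sub>F v in at_top. real n \<le> v" by (rule eventually_ge_at_top)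
      then show "\<forall>\<^sub>F v in inf at_top (principal Q). a < cond_exp_exceed M G T v W \<omega>"
        unfolding eventually_inf_principal
        by eventually_elim (use n elim(1) less_le_trans in blast)
    qed
  qed
qed

text \<open>This serves to exclude the constant branch at the minimal lag. Events of
  \<open>V\<close> differ only by null sets from events of \<open>V'\<close>, which lie in the
  joined algebra, and conditional probabilities do not see null sets.\<close>

lemma cond_indep_of_AE_eq_join_algebra:
  fixes T :: "'w \<Rightarrow> 'b" and V :: "'w \<Rightarrow> 'c"
  assumes M: "prob_space M" and G: "subalgebra M G"
    and U: "U \<in> measurable M N" and T: "T \<in> measurable M N'"
    and ci: "cond_indep M G N U N' T"
    and V: "V \<in> measurable M L" "V' \<in> measurable (join_algebra M G N U) L" "AE \<omega> in M. V \<omega> = V' \<omega>"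
  shows "cond_indep M G L V N' T"
  unfolding cond_indep_def
proof (intro ballI)
  fix A B assume A: "A \<in> sets L" and B: "B \<in> sets N'"
  interpret prob_space M by fact
  interpret G: sigma_finite_subalgebra M G by (rule prob_subalgebra_imp_sigma_finite[OF M G])
  define A' where "A' = V' -` A \<inter> space M"
  have A': "A' \<in> sets (join_algebra M G N U)"
    using measurable_sets[OF V(2) A] unfolding A'_def by (simp add: space_join_algebra[OF G])
  then have A'_M [measurable]: "A' \<in> sets M"
    using subalgebra_join_algebra[OF G U] unfolding subalgebra_def by blast
  have meas: "V -` A \<inter> space M \<in> sets M" "T -` B \<inter> space M \<in> sets M"
    using measurable_sets[OF V(1) A] measurable_sets[OF T B] by auto
  have eq: "V -` A \<inter> T -` B \<inter> space M = (V -` A \<inter> space M) \<inter> (T -` B \<inter> space M)" by auto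
  have "AE \<omega> in M. real_cond_exp M G (indicator (V -` A \<inter> T -` B \<inter> space M)) \<omega> =
      real_cond_exp M G (indicator (A' \<inter> (T -` B \<inter> space M))) \<omega>"
    unfolding eq
  proof (rule G.real_cond_exp_cong)
    show "AE \<omega> in M. indicat_real (V -` A \<inter> space M \<inter> (T -` B \<inter> space M)) \<omega> =
        indicator (A' \<inter> (T -` B \<inter> space M)) \<omega>"
      using V(3) by eventually_elim (simp add: A'_def indicator_def)
  qed (intro borel_measurable_indicator sets.Int meas A'_M)+
  moreover have "AE \<omega> in M. real_cond_exp M G (indicator (V -` A \<inter> space M)) \<omega> =
      real_cond_exp M G (indicator A') \<omega>"
  proof (rule G.real_cond_exp_cong)
    show "AE \<omega> in M. indicat_real (V -` A \<inter> space M) \<omega> = indicator A' \<omega>"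
      using V(3) by eventually_elim (simp add: A'_def indicator_def)
  qed (intro borel_measurable_indicator meas A'_M)+
  ultimately show "AE \<omega> in M. real_cond_exp M G (indicator (V -` A \<inter> T -` B \<inter> space M)) \<omega> =
      real_cond_exp M G (indicator (V -` A \<inter> space M)) \<omega> *
      real_cond_exp M G (indicator (T -` B \<inter> space M)) \<omega>"
    using cond_indep_join_algebra[OF M G U T ci B A'] by eventually_elim simp
qed

section \<open>The structural time series\<close>

lemma finite_coords: "finite (coords q :: ('d::finite, 'e::finite) coord set)"
proof -
  have "{ZLag i k |i k. i \<in> {1..q}} = (\<lambda>(i, k). ZLag i k) ` ({1..q} \<times> (UNIV :: 'd set))"
    by auto
  then have "finite {ZLag i k |i (k :: 'd). i \<in> {1..q}}"
    using finite_imageI finite_cartesian_product finite_atLeastAtMost finite by metis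
  then show ?thesis
    unfolding coords_def by (intro finite_UnI finite_imageI finite_atLeastAtMost finite)
qed

text \<open>One step of the recursion: all lags are at least 1, so every lagged slot refers to a
  time before \<open>s\<close>, while the noise is \<open>H\<close>-measurable and so responds
  trivially.\<close>

lemma tail_response_inputs:
  fixes Z :: "int \<Rightarrow> 'w \<Rightarrow> real ^ 'd" and eps :: "int \<Rightarrow> 'w \<Rightarrow> real ^ 'e"
  assumes "upper_tail_preserving (coords q) h" "AE \<omega> in M. V \<omega> = h (inputs q X Y Z eps s \<omega>)"
    and "\<And>r. r < s \<Longrightarrow> \<exists>\<phi>. tail_response M H T (X r) \<phi>"
    and "\<And>r. r < s \<Longrightarrow> \<exists>\<phi>. tail_response M H T (Y r) \<phi>"
    and "\<And>r k. r < s \<Longrightarrow> \<exists>\<phi>. tail_response M H T (\<lambda>\<omega>. Z r \<omega> $ k) \<phi>"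
    and eps: "eps s \<in> borel_measurable H"
  shows "\<exists>\<phi>. tail_response M H T V \<phi>"
proof (rule tail_response_compose[OF finite_coords assms(1)])
  let ?V = "\<lambda>c \<omega>. case c of
         XLag i \<Rightarrow> X (s - int i) \<omega>
       | YLag i \<Rightarrow> Y (s - int i) \<omega>
       | ZLag i k \<Rightarrow> Z (s - int i) \<omega> $ k
       | Noise k \<Rightarrow> eps s \<omega> $ k"
  show "AE \<omega> in M. V \<omega> = h (\<lambda>c\<in>coords q. ?V c \<omega>)"
    using assms(2) unfolding inputs_def .
  show "\<exists>\<phi>. tail_response M H T (?V c) \<phi>" if "c \<in> coords q" for c
  proof (cases c)
    case (Noise k)
    have "(\<lambda>\<omega>. eps s \<omega> $ k) \<in> borel_measurable H" 
      using eps by (rule measurable_compose) (intro borel_measurable_continuous_onI continuous_intros)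
    then show ?thesis unfolding Noise by (auto intro: tail_response_const)
  qed (use that assms(3-5) in \<open>auto simp: coords_def\<close>)
qed

section \<open>Measurability with respect to the past and the future noise\<close>

lemma
  assumes "\<And>s. X s \<in> borel_measurable M" "\<And>s. Y s \<in> borel_measurable M"
    and "\<And>s. Z s \<in> borel_measurable M"
  shows subalgebra_past_without_X: "subalgebra M (past_without_X M X Y Z t)"
    and measurable_X_past_without_X: "s < t \<Longrightarrow> X s \<in> borel_measurable (past_without_X M X Y Z t)"
    and measurable_Y_past_without_X: "s \<le> t \<Longrightarrow> Y s \<in> borel_measurable (past_without_X M X Y Z t)"
    and measurable_Z_past_without_X: "s \<le> t \<Longrightarrow> Z s \<in> borel_measurable (past_without_X M X Y Z t)"
proof -
  define E where "E = {X s -` B \<inter> space M |s B. s < t \<and> B \<in> sets borel} \<union>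
        {Y s -` B \<inter> space M |s B. s \<le> t \<and> B \<in> sets borel} \<union>
        {Z s -` B \<inter> space M |s B. s \<le> t \<and> B \<in> sets borel}"
  have past: "past_without_X M X Y Z t = sigma (space M) E"
    unfolding past_without_X_def E_def ..
  have "E \<subseteq> sets M"
    unfolding E_def using assms[THEN measurable_sets] by blast
  moreover have pow: "E \<subseteq> Pow (space M)" unfolding E_def by blast
  ultimately show "subalgebra M (past_without_X M X Y Z t)"
    unfolding past subalgebra_def by (simp add: sets.sigma_sets_subset)
  have in_past: "A \<in> sets (past_without_X M X Y Z t)" if "A \<in> E" for A
    using that pow unfolding past by auto
  have space: "space (past_without_X M X Y Z t) = space M"
    using pow unfolding past by simp
  have gen: "V \<in> borel_measurable (past_without_X M X Y Z t)"
    if "\<And>B. B \<in> sets borel \<Longrightarrow> V -` B \<inter> space M \<in> E" for V :: "'a \<Rightarrow> 'z :: topological_space"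
    using that in_past by (intro measurableI) (simp_all add: space)
  show "X s \<in> borel_measurable (past_without_X M X Y Z t)" if "s < t"
    by (rule gen, unfold E_def, rule UnI1, rule UnI1, rule CollectI) (use that in blast)
  show "Y s \<in> borel_measurable (past_without_X M X Y Z t)" if "s \<le> t"
    by (rule gen, unfold E_def, rule UnI1, rule UnI2, rule CollectI) (use that in blast)
  show "Z s \<in> borel_measurable (past_without_X M X Y Z t)" if "s \<le> t"
    by (rule gen, unfold E_def, rule UnI2, rule CollectI) (use that in blast)
qed

lemma measurable_future_noise:
  assumes "\<And>s. eX s \<in> borel_measurable M" "\<And>s. eY s \<in> borel_measurable M"
    and "\<And>s. eZ s \<in> borel_measurable M"
  shows "future_noise eX eY eZ t m \<in> measurable M (noise_space m)"
  unfolding future_noise_def noise_space_def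
  by (intro measurable_Pair measurable_restrict assms)

lemma
  assumes "future_noise eX eY eZ t m \<in> measurable H (noise_space m)" "i \<in> {1..m}"
  shows measurable_future_noiseX: "eX (t + int i) \<in> borel_measurable H"
    and measurable_future_noiseY: "eY (t + int i) \<in> borel_measurable H"
    and measurable_future_noiseZ: "eZ (t + int i) \<in> borel_measurable H"
proof -
  have pr: "(\<lambda>\<omega>. fst (future_noise eX eY eZ t m \<omega>)) \<in> measurable H (\<Pi>\<^sub>M i\<in>{1..m}. borel)"
    "(\<lambda>\<omega>. fst (snd (future_noise eX eY eZ t m \<omega>))) \<in> measurable H (\<Pi>\<^sub>M i\<in>{1..m}. borel)"
    "(\<lambda>\<omega>. snd (snd (future_noise eX eY eZ t m \<omega>))) \<in> measurable H (\<Pi>\<^sub>M i\<in>{1..m}. borel)"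
    using assms(1) unfolding noise_space_def by measurable
  from pr[THEN measurable_compose, OF measurable_component_singleton[OF assms(2)]]
  show "eX (t + int i) \<in> borel_measurable H" "eY (t + int i) \<in> borel_measurable H"
    "eZ (t + int i) \<in> borel_measurable H"
    using assms(2) by (simp_all add: future_noise_def)
qed

text \<open>An infimum in \<open>enat\<close> is attained unless the set is empty, and then it is
  infinite.\<close>

lemma min_lag_attained:
  assumes "min_lag M X Y Z t < \<infinity>"
  obtains l where "min_lag M X Y Z t = enat l" "1 \<le> l"
    "\<not> cond_indep M (past_without_X M X Y Z t) borel (Y (t + int l)) borel (X t)"
proof -
  define S where "S = {s. 1 \<le> s \<and>
       \<not> cond_indep M (past_without_X M X Y Z t) borel (Y (t + int s)) borel (X t)}"
  have "S \<noteq> {}" using assms unfolding min_lag_def S_def[symmetric] by (auto simp: top_enat_def)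
  then obtain s where "s \<in> S" by blast
  then have "Inf (enat ` S) \<in> enat ` S" by (intro wellorder_InfI[of "enat s"]) simp
  then show ?thesis using that unfolding min_lag_def S_def[symmetric] by (auto simp: S_def)
qed

theorem propositionS2:
  fixes M :: "'w measure"
    and X Y :: "int \<Rightarrow> 'w \<Rightarrow> real"
    and Z :: "int \<Rightarrow> 'w \<Rightarrow> real ^ 'd"
    and epsX :: "int \<Rightarrow> 'w \<Rightarrow> real ^ 'a"
    and epsY :: "int \<Rightarrow> 'w \<Rightarrow> real ^ 'b"
    and epsZ :: "int \<Rightarrow> 'w \<Rightarrow> real ^ 'c"
    and hX :: "(('d, 'a) coord \<Rightarrow> real) \<Rightarrow> real"
    and hY :: "(('d, 'b) coord \<Rightarrow> real) \<Rightarrow> real"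
    and hZ :: "(('d, 'c) coord \<Rightarrow> real) \<Rightarrow> real ^ 'd"
    and qX qY qZ :: nat
    and D :: "real measure"
    and t :: int
  assumes "prob_space M"
    and "\<And>s. X s \<in> borel_measurable M"
    and "\<And>s. Y s \<in> borel_measurable M"
    and "\<And>s. Z s \<in> borel_measurable M"
    and "\<And>s. epsX s \<in> borel_measurable M"
    and "\<And>s. epsY s \<in> borel_measurable M"
    and "\<And>s. epsZ s \<in> borel_measurable M"
    and "\<And>s. supported_near_infinity M (X s)"
    and "\<And>s. supported_near_infinity M (Y s)"
    and "real_distribution D"
    and "\<And>x. cdf D x < 1"
    and "\<And>s. AE \<omega> in M. Z s \<omega> = hZ (inputs qZ X Y Z epsZ s \<omega>)"
    and "\<And>s. AE \<omega> in M. X s \<omega> = hX (inputs qX X Y Z epsX s \<omega>)"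
    and "\<And>s. AE \<omega> in M. Y s \<omega> = hY (inputs qY X Y Z epsY s \<omega>)"
    and "upper_tail_preserving (coords qX) hX"
    and "upper_tail_preserving (coords qY) hY"
    and "\<And>k. upper_tail_preserving (coords qZ) (\<lambda>x. hZ x $ k)"
    and "\<And>s m. 1 \<le> m \<Longrightarrow>
           cond_indep M (past_without_X M X Y Z s)
             (noise_space m) (future_noise epsX epsY epsZ s m) borel (X s)"
    and "\<And>v. AE \<omega> in M. 0 < cond_prob_exceed M (past_without_X M X Y Z t) (X t) v \<omega>"
    and "min_lag M X Y Z t < \<infinity>"
  shows "\<forall>p. min_lag M X Y Z t \<le> enat p \<longrightarrow>
           causal_tail_coeff_is M X Y Z (cdf D) t p (\<lambda>\<omega>. 1)"
proof (intro allI impI)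
  fix p :: nat
  assume p: "min_lag M X Y Z t \<le> enat p"
  interpret prob_space M by fact
  interpret D: real_distribution D by fact
  obtain l where l: "min_lag M X Y Z t = enat l" "1 \<le> l"
    "\<not> cond_indep M (past_without_X M X Y Z t) borel (Y (t + int l)) borel (X t)"
    using min_lag_attained[OF assms(20)] by blast
  define G where "G = past_without_X M X Y Z t"
  define N :: "((nat \<Rightarrow> real ^ 'a) \<times> (nat \<Rightarrow> real ^ 'b) \<times> (nat \<Rightarrow> real ^ 'c)) measure"
    where "N = noise_space l"
  \<comment> \<open>The noise up to time \<open>t + l\<close> is all that the recursion uses between
    \<open>t\<close> and \<open>Y (t + int l)\<close>.\<close>
  define U where "U = future_noise epsX epsY epsZ t l"
  define H where "H = join_algebra M G N U"
  have G: "subalgebra M G"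
    unfolding G_def by (rule subalgebra_past_without_X[OF assms(2-4)])
  have U: "U \<in> measurable M N"
    unfolding U_def N_def by (rule measurable_future_noise[OF assms(5-7)])
  have ci: "cond_indep M G N U borel (X t)"
    unfolding G_def N_def U_def by (rule assms(18)[OF l(2)])
  have UH: "future_noise epsX epsY epsZ t l \<in> measurable H (noise_space l)"
    using measurable_join_algebra[OF G U] unfolding H_def U_def N_def .
  have GH: "f \<in> measurable H L" if "f \<in> measurable G L" for f :: "'w \<Rightarrow> 'z" and L
    using measurable_from_subalg[OF subalgebra_of_join_algebra[OF G U] that] unfolding H_def .
  define responds where "responds = (\<lambda>V. \<exists>\<phi>. tail_response M H (X t) V \<phi>)"
  have past: "responds V" if "V \<in> borel_measurable G" for V
    unfolding responds_def using tail_response_const[OF GH[OF that]] by blast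
  \<comment> \<open>The claim covers all times up to \<open>t + n\<close>, because the lags may
    reach far back; \<open>n\<close> stops at \<open>l\<close> because \<open>H\<close> contains the
    future noise only that far.\<close>
  have steps: "responds (X s) \<and> responds (Y s) \<and> (\<forall>k. responds (\<lambda>\<omega>. Z s \<omega> $ k))"
    if "n \<le> l" "s \<le> t + int n" for n s
    using that
  proof (induction n arbitrary: s)
    case 0
    \<comment> \<open>At times up to \<open>t\<close>, \<open>X t\<close> responds to itself by the
      identity, the source of divergence; every other variable is \<open>G\<close>-measurable and
      responds as a constant.\<close>
    have "responds (X s)"
    proof (cases "s = t")
      case True
      then show ?thesis unfolding responds_def using tail_response_self by blast
    qed (use 0 past measurable_X_past_without_X[OF assms(2-4)] in \<open>auto simp: G_def\<close>)
    moreover have "responds (Y s)"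
      using 0 by (intro past) (auto simp: G_def intro!: measurable_Y_past_without_X[OF assms(2-4)])
    moreover have "responds (\<lambda>\<omega>. Z s \<omega> $ k)" for k
    proof (rule past)
      have "Z s \<in> borel_measurable G"
        using 0 by (auto simp: G_def intro!: measurable_Z_past_without_X[OF assms(2-4)])
      then show "(\<lambda>\<omega>. Z s \<omega> $ k) \<in> borel_measurable G"
        by (rule measurable_compose) (intro borel_measurable_continuous_onI continuous_intros)
    qed
    ultimately show ?case by blast
  next
    case (Suc n)
    show ?case
    proof (cases "s = t + int (Suc n)")
      case False
      then show ?thesis using Suc by auto
    next
      case True
      have lags: "\<exists>\<phi>. tail_response M H (X t) (X r) \<phi>" "\<exists>\<phi>. tail_response M H (X t) (Y r) \<phi>"
        "\<exists>\<phi>. tail_response M H (X t) (\<lambda>\<omega>. Z r \<omega> $ k) \<phi>" if "r < s" for r k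
        using Suc.IH[of r] Suc.prems(1) that True unfolding responds_def by auto
      have "Suc n \<in> {1..l}" using Suc.prems(1) by simp
      note noise = measurable_future_noiseX[OF UH this] measurable_future_noiseY[OF UH this]
        measurable_future_noiseZ[OF UH this]
      \<comment> \<open>Responses are real-valued, so \<open>Z\<close> is treated one component at a
        time.\<close>
      have "AE \<omega> in M. Z s \<omega> $ k = hZ (inputs qZ X Y Z epsZ s \<omega>) $ k" for k
        using assms(12)[of s] by eventually_elim simp
      then have "\<exists>\<phi>. tail_response M H (X t) (\<lambda>\<omega>. Z s \<omega> $ k) \<phi>" for k
        by (rule tail_response_inputs[OF assms(17)]) (use lags noise(3) True in simp_all)
      moreover have "\<exists>\<phi>. tail_response M H (X t) (X s) \<phi>"
        by (rule tail_response_inputs[OF assms(15,13)]) (use lags noise(1) True in simp_all)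
      moreover have "\<exists>\<phi>. tail_response M H (X t) (Y s) \<phi>"
        by (rule tail_response_inputs[OF assms(16,14)]) (use lags noise(2) True in simp_all)
      ultimately show ?thesis unfolding responds_def by blast
    qed
  qed
  obtain \<phi> where \<phi>: "tail_response M H (X t) (Y (t + int l)) \<phi>"
    using steps[of l "t + int l"] unfolding responds_def by blast
  \<comment> \<open>A constant response would make \<open>Y (t + int l)\<close> almost surely
    \<open>H\<close>-measurable, hence conditionally independent of \<open>X t\<close>, against the
    choice of \<open>l\<close>.\<close>
  have "\<not> (\<forall>\<omega> x y. \<phi> x \<omega> = \<phi> y \<omega>)"
  proof
    assume const: "\<forall>\<omega> x y. \<phi> x \<omega> = \<phi> y \<omega>"
    have "AE \<omega> in M. Y (t + int l) \<omega> = \<phi> (X t \<omega>) \<omega>"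
      using \<phi> unfolding tail_response_def by blast
    then have "AE \<omega> in M. Y (t + int l) \<omega> = \<phi> 0 \<omega>"
      by eventually_elim (use const in metis)
    moreover have "\<phi> 0 \<in> borel_measurable (join_algebra M G N U)"
      using \<phi> unfolding tail_response_def H_def by blast
    ultimately have "cond_indep M G borel (Y (t + int l)) borel (X t)"
      by (intro cond_indep_of_AE_eq_join_algebra[OF assms(1) G U assms(2) ci assms(3)])
    then show False using l(3) unfolding G_def by contradiction
  qed
  then have lim: "filterlim (\<lambda>x. \<phi> x \<omega>) at_top at_top" for \<omega>
    using \<phi> unfolding tail_response_def by blast
  let ?W = "\<lambda>\<omega>. Max ((\<lambda>s. cdf D (Y (t + int s) \<omega>)) ` {1..p})"
  \<comment> \<open>This puts the diverging term among those of the maximum, and makes the index set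
    nonempty so that the bounds on \<open>Max\<close> apply.\<close>
  have lp: "l \<in> {1..p}" using p l(1,2) by simp
  have mono: "mono (cdf D)" by (intro monoI D.cdf_nondecreasing)
  have "cond_exp_exceed_limit M G (X t) ?W (\<lambda>_. 1)"
  proof (rule cond_exp_exceed_limit_tail_response[OF assms(1) G U assms(2) ci \<phi>[unfolded H_def] lim mono])
    show "?W \<in> borel_measurable M"
      by (intro borel_measurable_Max finite_atLeastAtMost measurable_compose[OF assms(3)]
          borel_measurable_mono mono)
    show "?W \<omega> \<le> 1" for \<omega>
      using lp by (intro Max.boundedI) (auto simp: D.cdf_bounded_prob)
    show "cdf D (Y (t + int l) \<omega>) \<le> ?W \<omega>" for \<omega>
      using lp by (intro Max_ge) auto
    show "AE \<omega> in M. 0 < cond_prob_exceed M G (X t) v \<omega>" for v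
      unfolding G_def by (rule assms(19))
  qed (auto simp: D.cdf_nonneg D.cdf_lim_at_top_prob)
  then show "causal_tail_coeff_is M X Y Z (cdf D) t p (\<lambda>\<omega>. 1)"
    unfolding causal_tail_coeff_is_def G_def .
qed

end
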